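(* Let $A$ be a metric space, $\sigma:\mathbb{R}^N\times A\to\mathbb{R}^{N\times m}$, $b:\mathbb{R}^N\times A\to\mathbb{R}^N$ continuous, $a=\sigma\sigma^T$, such that for every $R>0$ there is $K_R$ with $\sup_{|x|\le R,\alpha}(|\sigma|+|b|)\le K_R$, $|\sigma(x,\alpha)-\sigma(y,\alpha)|+|b(x,\alpha)-b(y,\alpha)|\le K_R|x-y|$ for $|x|,|y|\le R$, and $\xi^Ta(x,\alpha)\xi\ge|\xi|^2/K_R$ for all $\xi$, $|x|\le R$, $\alpha$. Let $l:\mathbb{R}^N\times A\to\mathbb{R}$ be continuous, bounded, uniformly continuous in $x$ uniformly in $\alpha$, and let $F(x,p,X)$ be either $\inf_{\alpha}\{-\mathrm{tr}(a(x,\alpha)X)-b(x,\alpha)\cdot p-l(x,\alpha)\}$ or $\sup_\alpha\{-\mathrm{tr}(a(x,\alpha)X)-b(x,\alpha)\cdot p-l(x,\alpha)\}$. Assume that for every $M>0$ there is $R>0$ with $\sup_\alpha\{\mathrm{tr}\,a(x,\alpha)+b(x,\alpha)\cdot x\}\le-M$ for $|x|\ge R$. Let $c\in\mathbb{R}$ and $\chi$ be a viscosity solution of $F(x,D\chi,D^2\chi)=c$ in $\mathbb{R}^N$ with $\lim_{|x|\to\infty}\chi(x)/|x|^2=0$. Suppose moreover there exist $\rho>0$ and $R>0$ such that $$\sup_{\alpha\in A}\{\mathrm{tr}\,a(x,\alpha)+b(x,\alpha)\cdot x\}\le-\frac{2|c|+\|l\|_\infty}{\rho}|x|^{2+\rho}\quad\text{for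 }|x|\ge R.$$ Then for all $|x|\ge R$, $$\min_{|y|\le R}\chi(y)+\frac1{|x|^\rho}-\frac1{R^\rho}\le\chi(x)\le\max_{|y|\le R}\chi(y)-\frac1{|x|^\rho}+\frac1{R^\rho},$$ and in particular $\chi\in L^\infty(\mathbb{R}^N)$.
   Context: Solutions are viscosity solutions; $\|l\|_\infty=\sup_{\mathbb{R}^N\times A}|l|$. (Under these assumptions, such a pair $(c,\chi)$ exists, $c$ is unique, and $\chi$ is unique up to additive constants.) *)

theory Defs
  imports "HOL-Analysis.Analysis"
begin

text \<open>phi is C^2 on R^N with gradient Dphi and Hessian D2phi (continuous).\<close>
definition C2_with :: "(real^'n \<Rightarrow> real) \<Rightarrow> (real^'n \<Rightarrow> real^'n) \<Rightarrow> (real^'n \<Rightarrow> real^'n^'n) \<Rightarrow> bool" where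
  "C2_with phi Dphi D2phi \<longleftrightarrow>
     (\<forall>x. (phi has_derivative (\<lambda>h. Dphi x \<bullet> h)) (at x)) \<and>
     (\<forall>x. (Dphi has_derivative (\<lambda>h. D2phi x *v h)) (at x)) \<and>
     continuous_on UNIV D2phi"

text \<open>Viscosity sub/supersolutions of F(x,Du,D^2u) = c in R^N (continuous functions,
  C^2 test functions, local extrema).\<close>
definition visc_subsol :: "(real^'n \<Rightarrow> real^'n \<Rightarrow> real^'n^'n \<Rightarrow> real) \<Rightarrow> real \<Rightarrow> (real^'n \<Rightarrow> real) \<Rightarrow> bool" where
  "visc_subsol F c u \<longleftrightarrow> continuous_on UNIV u \<and>
     (\<forall>phi Dphi D2phi x0. C2_with phi Dphi D2phi \<and>
        (\<exists>e>0. \<forall>y. dist y x0 < e \<longrightarrow> u y - phi y \<le> u x0 - phi x0)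
        \<longrightarrow> F x0 (Dphi x0) (D2phi x0) \<le> c)"

definition visc_supersol :: "(real^'n \<Rightarrow> real^'n \<Rightarrow> real^'n^'n \<Rightarrow> real) \<Rightarrow> real \<Rightarrow> (real^'n \<Rightarrow> real) \<Rightarrow> bool" where
  "visc_supersol F c u \<longleftrightarrow> continuous_on UNIV u \<and>
     (\<forall>phi Dphi D2phi x0. C2_with phi Dphi D2phi \<and>
        (\<exists>e>0. \<forall>y. dist y x0 < e \<longrightarrow> u y - phi y \<ge> u x0 - phi x0)
        \<longrightarrow> F x0 (Dphi x0) (D2phi x0) \<ge> c)"

definition visc_sol :: "(real^'n \<Rightarrow> real^'n \<Rightarrow> real^'n^'n \<Rightarrow> real) \<Rightarrow> real \<Rightarrow> (real^'n \<Rightarrow> real) \<Rightarrow> bool" where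
  "visc_sol F c u \<longleftrightarrow> visc_subsol F c u \<and> visc_supersol F c u"

text \<open>Diffusion matrix a = sigma sigma^T.\<close>
definition diffm :: "(real^'n \<Rightarrow> 'a \<Rightarrow> real^'m^'n) \<Rightarrow> real^'n \<Rightarrow> 'a \<Rightarrow> real^'n^'n" where
  "diffm \<sigma> x \<alpha> = \<sigma> x \<alpha> ** transpose (\<sigma> x \<alpha>)"

definition bellman_inf :: "(real^'n \<Rightarrow> 'a \<Rightarrow> real^'m^'n) \<Rightarrow> (real^'n \<Rightarrow> 'a \<Rightarrow> real^'n) \<Rightarrow> (real^'n \<Rightarrow> 'a \<Rightarrow> real)
    \<Rightarrow> real^'n \<Rightarrow> real^'n \<Rightarrow> real^'n^'n \<Rightarrow> real" where
  "bellman_inf \<sigma> b l x p X = (INF \<alpha>. - trace (diffm \<sigma> x \<alpha> ** X) - b x \<alpha> \<bullet> p - l x \<alpha>)"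

definition bellman_sup :: "(real^'n \<Rightarrow> 'a \<Rightarrow> real^'m^'n) \<Rightarrow> (real^'n \<Rightarrow> 'a \<Rightarrow> real^'n) \<Rightarrow> (real^'n \<Rightarrow> 'a \<Rightarrow> real)
    \<Rightarrow> real^'n \<Rightarrow> real^'n \<Rightarrow> real^'n^'n \<Rightarrow> real" where
  "bellman_sup \<sigma> b l x p X = (SUP \<alpha>. - trace (diffm \<sigma> x \<alpha> ** X) - b x \<alpha> \<bullet> p - l x \<alpha>)"

text \<open>sup norm of l over R^N x A.\<close>
definition sup_norm :: "(real^'n \<Rightarrow> 'a \<Rightarrow> real) \<Rightarrow> real" where
  "sup_norm l = (SUP z. \<bar>l (fst z) (snd z)\<bar>)"

end

theory Submission
  imports Defs
begin

text \<open>
  Since \<open>-\<chi>\<close> is a subsolution of the dual equation with \<open>-l\<close> (which swaps \<open>inf\<close> and \<open>sup\<close>),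
  it suffices to prove the upper bound. Let \<open>M\<close> be the maximum of \<open>\<chi>\<close> on the ball of radius \<open>R\<close>
  and compare \<open>\<chi>\<close> with the radial barrier
  \<open>M + (R\<^sup>2 + \<delta>)\<^bsup>-\<rho>/2\<^esup> - (|x|\<^sup>2 + \<delta>)\<^bsup>-\<rho>/2\<^esup> + \<epsilon>|x|\<^sup>2\<close>. It dominates \<open>\<chi>\<close> on the sphere
  \<open>|x| = R\<close> and, by the subquadratic growth of \<open>\<chi>\<close>, far out. If \<open>\<chi>\<close> exceeded it somewhere
  outside the ball, \<open>\<chi>\<close> minus the barrier would have a local maximum at some \<open>|x\<^sub>0| > R\<close>,
  where the subsolution property gives \<open>F \<le> c\<close>. But for \<open>|x| \<ge> R\<close> the strong Lyapunov bound
  makes the first-order part of the operator at least \<open>2|c| + \<parallel>l\<parallel>\<^sub>\<infinity>\<close> up to a factor that tends to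
  \<open>1\<close> as \<open>\<delta> \<rightarrow> 0\<close>, and uniform ellipticity makes the second-order part strictly positive, enough
  to absorb that loss; so \<open>F > c\<close> there. Letting \<open>\<epsilon>, \<delta> \<rightarrow> 0\<close> gives the bound.
\<close>

lemma trace_mult_transpose_self:
  fixes S :: "real^'m^'n"
  shows "trace (S ** transpose S) = (norm S)\<^sup>2"
  by (simp add: power2_norm_eq_inner inner_vec_def trace_def matrix_matrix_mult_def transpose_def)

lemma inner_mult_transpose_self:
  fixes S :: "real^'m^'n"
  shows "x \<bullet> ((S ** transpose S) *v x) = (norm (transpose S *v x))\<^sup>2"
proof -
  have "x \<bullet> ((S ** transpose S) *v x) = (x v* S) \<bullet> (transpose S *v x)"
    by (simp add: dot_lmul_matrix flip: matrix_vector_mul_assoc)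
  then show ?thesis
    by (metis power2_norm_eq_inner transpose_transpose vector_transpose_matrix)
qed

lemma norm_transpose:
  fixes A :: "real^'m^'n"
  shows "norm (transpose A) = norm A"
proof -
  have "(norm (transpose A))\<^sup>2 = (norm A)\<^sup>2"
    unfolding power2_norm_eq_inner inner_vec_def transpose_def
    by (subst sum.swap) simp
  then show ?thesis by (simp add: power2_eq_iff_nonneg)
qed

lemma norm_matrix_vector_mult_le:
  fixes A :: "real^'m^'n"
  shows "norm (A *v x) \<le> norm A * norm x"
proof -
  have "(norm (A *v x))\<^sup>2 = (\<Sum>i\<in>UNIV. (A$i \<bullet> x)\<^sup>2)"
    unfolding power2_norm_eq_inner inner_vec_def matrix_vector_mul_component
    by (simp add: power2_eq_square)
  also have "\<dots> \<le> (\<Sum>i\<in>UNIV. (norm (A$i))\<^sup>2 * (norm x)\<^sup>2)"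
    by (intro sum_mono) (metis Cauchy_Schwarz_ineq2 abs_ge_zero power_mono power_mult_distrib power2_abs)
  also have "\<dots> = (norm A * norm x)\<^sup>2"
    by (simp add: power_mult_distrib norm_vec_def L2_set_def sum_nonneg flip: sum_distrib_right)
  finally show ?thesis by (simp add: power2_le_iff_abs_le)
qed

lemma trace_mult_uminus_right:
  fixes A X :: "real^'n^'n"
  shows "trace (A ** - X) = - trace (A ** X)"
  by (simp add: trace_def matrix_matrix_mult_def sum_negf)

lemma uminus_matrix_vector_mult:
  fixes M :: "real^'n^'m"
  shows "(- M) *v h = - (M *v h)"
  by (simp add: vec_eq_iff matrix_vector_mult_def sum_negf)

text \<open>The Hessian of \<open>x \<mapsto> h (x \<bullet> x)\<close> is \<open>radial_hessian (h' (x \<bullet> x)) (h'' (x \<bullet> x)) x\<close>.\<close>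
definition radial_hessian :: "real \<Rightarrow> real \<Rightarrow> real^'n \<Rightarrow> real^'n^'n" where
  "radial_hessian g1 g2 x = (\<chi> i j. 2 * g1 * (if i = j then 1 else 0) + 4 * g2 * x$i * x$j)"

lemma radial_hessian_mult_vector:
  "radial_hessian g1 g2 x *v k = (2 * g1) *\<^sub>R k + (4 * g2 * (x \<bullet> k)) *\<^sub>R x"
proof (subst vec_eq_iff, intro allI)
  fix i
  have "(radial_hessian g1 g2 x *v k) $ i
      = (\<Sum>j\<in>UNIV. (if j = i then 2 * g1 * k$i else 0) + 4 * g2 * x$i * (x$j * k$j))"
    by (auto simp: radial_hessian_def matrix_vector_mult_def algebra_simps intro!: sum.cong)
  also have "\<dots> = 2 * g1 * k$i + 4 * g2 * x$i * (x \<bullet> k)"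
    by (simp add: sum.distrib inner_vec_def sum_distrib_left)
  finally show "(radial_hessian g1 g2 x *v k) $ i = ((2 * g1) *\<^sub>R k + (4 * g2 * (x \<bullet> k)) *\<^sub>R x) $ i"
    by (simp add: algebra_simps)
qed

lemma trace_mult_radial_hessian:
  fixes A :: "real^'n^'n"
  shows "trace (A ** radial_hessian g1 g2 x) = 2 * g1 * trace A + 4 * g2 * (x \<bullet> (A *v x))"
proof -
  have "(A ** radial_hessian g1 g2 x) $ i $ i
      = (\<Sum>k\<in>UNIV. (if k = i then 2 * g1 * A$i$i else 0) + 4 * g2 * (x$i * (A$i$k * x$k)))" for i
    by (auto simp: radial_hessian_def matrix_matrix_mult_def algebra_simps intro!: sum.cong)
  then show ?thesis
    by (simp add: trace_def inner_vec_def matrix_vector_mult_def sum.distrib sum_distrib_left)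
qed

lemma C2_with_radial:
  fixes h h1 h2 :: "real \<Rightarrow> real"
  assumes h: "\<And>r. 0 \<le> r \<Longrightarrow> (h has_real_derivative h1 r) (at r)"
    and h1: "\<And>r. 0 \<le> r \<Longrightarrow> (h1 has_real_derivative h2 r) (at r)"
    and h2: "continuous_on {0..} h2"
  shows "C2_with (\<lambda>x::real^'n. h (x \<bullet> x)) (\<lambda>x. (2 * h1 (x \<bullet> x)) *\<^sub>R x)
           (\<lambda>x. radial_hessian (h1 (x \<bullet> x)) (h2 (x \<bullet> x)) x)"
  unfolding C2_with_def
proof (intro conjI allI)
  fix x :: "real^'n"
  have sq: "((\<lambda>x. x \<bullet> x) has_derivative (\<lambda>k. 2 * (x \<bullet> k))) (at x)"
    by (rule has_derivative_eq_rhs[OF has_derivative_inner[OF has_derivative_ident has_derivative_ident]])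
       (simp add: fun_eq_iff inner_commute)
  have "(h has_derivative (\<lambda>d. h1 (x \<bullet> x) * d)) (at (x \<bullet> x))"
    using h[of "x \<bullet> x"] by (simp add: has_field_derivative_def)
  from has_derivative_compose[OF sq this]
  show "((\<lambda>x. h (x \<bullet> x)) has_derivative (\<lambda>k. (2 * h1 (x \<bullet> x)) *\<^sub>R x \<bullet> k)) (at x)"
    by (rule has_derivative_eq_rhs) (simp add: fun_eq_iff)
  have "(h1 has_derivative (\<lambda>d. h2 (x \<bullet> x) * d)) (at (x \<bullet> x))"
    using h1[of "x \<bullet> x"] by (simp add: has_field_derivative_def)
  from has_derivative_mult_right[OF has_derivative_compose[OF sq this], of 2]
  have "((\<lambda>x. 2 * h1 (x \<bullet> x)) has_derivative (\<lambda>k. 4 * h2 (x \<bullet> x) * (x \<bullet> k))) (at x)"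
    by (rule has_derivative_eq_rhs) (simp add: fun_eq_iff)
  from has_derivative_scaleR[OF this has_derivative_ident]
  show "((\<lambda>x. (2 * h1 (x \<bullet> x)) *\<^sub>R x) has_derivative
          (*v) (radial_hessian (h1 (x \<bullet> x)) (h2 (x \<bullet> x)) x)) (at x)"
    by (rule has_derivative_eq_rhs) (simp add: fun_eq_iff radial_hessian_mult_vector)
next
  have "continuous_on {0..} h1"
    by (rule continuous_at_imp_continuous_on) (auto intro: DERIV_isCont h1)
  then have "continuous_on UNIV (\<lambda>x::real^'n. h1 (x \<bullet> x))"
    and "continuous_on UNIV (\<lambda>x::real^'n. h2 (x \<bullet> x))"
    by (auto intro!: continuous_on_compose2[OF _ continuous_on_inner[OF continuous_on_id continuous_on_id]] h2)
  then show "continuous_on UNIV (\<lambda>x::real^'n. radial_hessian (h1 (x \<bullet> x)) (h2 (x \<bullet> x)) x)"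
    unfolding radial_hessian_def by (intro continuous_on_vec_lambda continuous_intros)
qed

lemma C2_with_uminus:
  assumes "C2_with phi Dphi D2phi"
  shows "C2_with (\<lambda>x. - phi x) (\<lambda>x. - Dphi x) (\<lambda>x. - D2phi x)"
  using assms unfolding C2_with_def
proof (intro conjI allI; elim conjE)
  fix x
  assume "\<forall>x. (phi has_derivative (\<lambda>h. Dphi x \<bullet> h)) (at x)"
  from has_derivative_minus[OF this[rule_format, of x]]
  show "((\<lambda>x. - phi x) has_derivative (\<lambda>h. - Dphi x \<bullet> h)) (at x)" by simp
  assume "\<forall>x. (Dphi has_derivative (*v) (D2phi x)) (at x)"
  from has_derivative_minus[OF this[rule_format, of x]]
  show "((\<lambda>x. - Dphi x) has_derivative (*v) (- D2phi x)) (at x)"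
    by (rule has_derivative_eq_rhs) (simp_all add: fun_eq_iff uminus_matrix_vector_mult)
next
  assume "continuous_on UNIV D2phi"
  then show "continuous_on UNIV (\<lambda>x. - D2phi x)" by (rule continuous_on_minus)
qed

lemma visc_supersol_imp_visc_subsol_uminus:
  assumes sup: "visc_supersol F c u" and G: "\<And>x p X. G x p X = - F x (- p) (- X)"
  shows "visc_subsol G (- c) (\<lambda>x. - u x)"
  unfolding visc_subsol_def
proof (intro conjI allI impI)
  show "continuous_on UNIV (\<lambda>x. - u x)"
    using sup by (intro continuous_on_minus) (simp add: visc_supersol_def)
next
  fix phi Dphi D2phi x0
  assume "C2_with phi Dphi D2phi \<and> (\<exists>e>0. \<forall>y. dist y x0 < e \<longrightarrow> - u y - phi y \<le> - u x0 - phi x0)"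
  then have "C2_with (\<lambda>x. - phi x) (\<lambda>x. - Dphi x) (\<lambda>x. - D2phi x) \<and>
      (\<exists>e>0. \<forall>y. dist y x0 < e \<longrightarrow> u y - (- phi y) \<ge> u x0 - (- phi x0))"
    using C2_with_uminus by force
  then have "c \<le> F x0 (- Dphi x0) (- D2phi x0)"
    using sup unfolding visc_supersol_def by blast
  then show "G x0 (Dphi x0) (D2phi x0) \<le> - c" by (simp add: G)
qed

lemma bellman_sup_uminus:
  "bellman_sup \<sigma> b (\<lambda>x \<alpha>. - l x \<alpha>) x p X = - bellman_inf \<sigma> b l x (- p) (- X)"
  unfolding bellman_sup_def bellman_inf_def
  by (simp add: Inf_real_def image_image trace_mult_uminus_right algebra_simps)

lemma bellman_inf_uminus:
  "bellman_inf \<sigma> b (\<lambda>x \<alpha>. - l x \<alpha>) x p X = - bellman_sup \<sigma> b l x (- p) (- X)"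
  unfolding bellman_sup_def bellman_inf_def
  by (simp add: Inf_real_def image_image trace_mult_uminus_right algebra_simps)

lemma square_powr:
  fixes s :: real
  assumes "0 \<le> s"
  shows "(s\<^sup>2) powr a = s powr (2 * a)"
  using powr_powr[of s 2 a] powr_numeral[OF assms, of "num.Bit0 num.One"] by simp

lemma one_div_powr_eq_square_powr:
  fixes s :: real
  assumes "0 \<le> s"
  shows "1 / s powr \<rho> = (s\<^sup>2) powr (- \<rho> / 2)"
  using assms by (simp add: square_powr powr_minus_divide)

lemma square_ratio_powr_le:
  fixes R s \<delta> \<rho> :: real
  assumes "0 < R" "R \<le> s" "0 \<le> \<delta>" "0 < \<rho>"
  shows "(R\<^sup>2 / (R\<^sup>2 + \<delta>)) powr ((\<rho> + 2) / 2) \<le> (s\<^sup>2 + \<delta>) powr (- \<rho> / 2 - 1) * s powr (2 + \<rho>)"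
proof -
  have T: "0 < s\<^sup>2 + \<delta>" and TR: "0 < R\<^sup>2 + \<delta>" using assms by (auto simp: add_pos_nonneg)
  have "s powr (2 + \<rho>) = (s\<^sup>2) powr ((\<rho> + 2) / 2)"
    using assms square_powr[of s "(\<rho> + 2) / 2"] by (simp only: mult_2_right add_divide_distrib) (simp add: add.commute)
  moreover have "- \<rho> / 2 - 1 = - ((\<rho> + 2) / 2)" by (simp add: field_simps)
  then have "(s\<^sup>2 + \<delta>) powr (- \<rho> / 2 - 1) = 1 / (s\<^sup>2 + \<delta>) powr ((\<rho> + 2) / 2)"
    by (simp only: powr_minus_divide)
  ultimately have eq: "(s\<^sup>2 + \<delta>) powr (- \<rho> / 2 - 1) * s powr (2 + \<rho>) = (s\<^sup>2 / (s\<^sup>2 + \<delta>)) powr ((\<rho> + 2) / 2)"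
    by (simp add: powr_divide)
  have "R\<^sup>2 * \<delta> \<le> s\<^sup>2 * \<delta>"
    using assms by (intro mult_right_mono power_mono) auto
  then have "R\<^sup>2 / (R\<^sup>2 + \<delta>) \<le> s\<^sup>2 / (s\<^sup>2 + \<delta>)"
    using T TR by (simp add: divide_simps algebra_simps)
  then show ?thesis
    unfolding eq using assms by (intro powr_mono2) auto
qed

text \<open>The offset \<open>\<delta> > 0\<close> regularises \<open>|x|\<^bsup>-\<rho>\<^esup>\<close> at the origin, so that the barrier is a
  global \<open>C\<^sup>2\<close> test function.\<close>
definition barrier :: "real \<Rightarrow> real \<Rightarrow> real \<Rightarrow> real^'n \<Rightarrow> real" where
  "barrier \<rho> \<delta> \<epsilon> x = \<epsilon> * (norm x)\<^sup>2 - ((norm x)\<^sup>2 + \<delta>) powr (- \<rho> / 2)"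

definition barrier_gradient :: "real \<Rightarrow> real \<Rightarrow> real \<Rightarrow> real^'n \<Rightarrow> real^'n" where
  "barrier_gradient \<rho> \<delta> \<epsilon> x = (\<rho> * ((norm x)\<^sup>2 + \<delta>) powr (- \<rho> / 2 - 1) + 2 * \<epsilon>) *\<^sub>R x"

definition barrier_hessian :: "real \<Rightarrow> real \<Rightarrow> real \<Rightarrow> real^'n \<Rightarrow> real^'n^'n" where
  "barrier_hessian \<rho> \<delta> \<epsilon> x = radial_hessian
     (\<rho> / 2 * ((norm x)\<^sup>2 + \<delta>) powr (- \<rho> / 2 - 1) + \<epsilon>)
     (- \<rho> * (\<rho> + 2) / 4 * ((norm x)\<^sup>2 + \<delta>) powr (- \<rho> / 2 - 2)) x"

lemma C2_with_barrier:
  assumes "0 < \<delta>"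
  shows "C2_with (barrier \<rho> \<delta> \<epsilon>) (barrier_gradient \<rho> \<delta> \<epsilon>) (barrier_hessian \<rho> \<delta> \<epsilon>)"
proof -
  define h1 where "h1 r = \<rho> / 2 * (r + \<delta>) powr (- \<rho> / 2 - 1) + \<epsilon>" for r
  define h2 where "h2 r = - \<rho> * (\<rho> + 2) / 4 * (r + \<delta>) powr (- \<rho> / 2 - 2)" for r
  have "((\<lambda>r. \<epsilon> * r - (r + \<delta>) powr (- \<rho> / 2)) has_real_derivative h1 r) (at r)" if "0 \<le> r" for r
    using that assms unfolding h1_def
    by (auto intro!: derivative_eq_intros simp: field_simps)
  moreover have "(h1 has_real_derivative h2 r) (at r)" if "0 \<le> r" for r
    using that assms unfolding h1_def h2_def
    by (auto intro!: derivative_eq_intros simp: field_simps)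
  moreover have "continuous_on {0..} h2"
    using assms unfolding h2_def by (intro continuous_intros) auto
  ultimately have radial: "C2_with (\<lambda>x::real^'n. \<epsilon> * (x \<bullet> x) - (x \<bullet> x + \<delta>) powr (- \<rho> / 2))
      (\<lambda>x. (2 * h1 (x \<bullet> x)) *\<^sub>R x) (\<lambda>x. radial_hessian (h1 (x \<bullet> x)) (h2 (x \<bullet> x)) x)"
    by (rule C2_with_radial)
  have eqs: "barrier \<rho> \<delta> \<epsilon> = (\<lambda>x. \<epsilon> * (x \<bullet> x) - (x \<bullet> x + \<delta>) powr (- \<rho> / 2))"
    "barrier_gradient \<rho> \<delta> \<epsilon> = (\<lambda>x. (2 * h1 (x \<bullet> x)) *\<^sub>R x)"
    "barrier_hessian \<rho> \<delta> \<epsilon> = (\<lambda>x. radial_hessian (h1 (x \<bullet> x)) (h2 (x \<bullet> x)) x)"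
    by (simp_all add: fun_eq_iff barrier_def barrier_gradient_def barrier_hessian_def h1_def h2_def
        power2_norm_eq_inner algebra_simps)
  show ?thesis unfolding eqs by (rule radial)
qed

lemma barrier_integrand_eq:
  fixes A :: "real^'n^'n"
  shows "- trace (A ** barrier_hessian \<rho> \<delta> \<epsilon> x) - \<beta> \<bullet> barrier_gradient \<rho> \<delta> \<epsilon> x
    = - (\<rho> * ((norm x)\<^sup>2 + \<delta>) powr (- \<rho> / 2 - 1) + 2 * \<epsilon>) * (trace A + \<beta> \<bullet> x)
      + \<rho> * (\<rho> + 2) * ((norm x)\<^sup>2 + \<delta>) powr (- \<rho> / 2 - 2) * (x \<bullet> (A *v x))"
  unfolding barrier_hessian_def barrier_gradient_def trace_mult_radial_hessian inner_scaleR_right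
  by (simp add: field_simps)

lemma barrier_integrand_ge:
  fixes A :: "real^'n^'n"
  assumes "0 < \<rho>" "0 < R" "R \<le> norm x" "norm x \<le> S" "0 < \<delta>" "\<delta> \<le> 1" "0 \<le> \<epsilon>" "0 \<le> D" "0 < K"
    and drift: "trace A + \<beta> \<bullet> x \<le> - (D / \<rho>) * norm x powr (2 + \<rho>)"
    and elliptic: "(norm x)\<^sup>2 / K \<le> x \<bullet> (A *v x)"
  shows "D * (R\<^sup>2 / (R\<^sup>2 + \<delta>)) powr ((\<rho> + 2) / 2) + \<rho> * (\<rho> + 2) * (S\<^sup>2 + 1) powr (- \<rho> / 2 - 2) * R\<^sup>2 / K
    \<le> - trace (A ** barrier_hessian \<rho> \<delta> \<epsilon> x) - \<beta> \<bullet> barrier_gradient \<rho> \<delta> \<epsilon> x"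
proof -
  define T where "T = (norm x)\<^sup>2 + \<delta>"
  have T: "0 < T" "T \<le> S\<^sup>2 + 1"
    using assms by (auto simp: T_def add_nonneg_pos intro!: add_mono power_mono)
  have "D * (R\<^sup>2 / (R\<^sup>2 + \<delta>)) powr ((\<rho> + 2) / 2) \<le> D * (T powr (- \<rho> / 2 - 1) * norm x powr (2 + \<rho>))"
    unfolding T_def using assms by (intro mult_left_mono square_ratio_powr_le) auto
  also have "\<dots> = \<rho> * T powr (- \<rho> / 2 - 1) * (D / \<rho> * norm x powr (2 + \<rho>))"
    using assms by simp
  also have "\<dots> \<le> (\<rho> * T powr (- \<rho> / 2 - 1) + 2 * \<epsilon>) * - (trace A + \<beta> \<bullet> x)"
    using assms drift by (intro mult_mono) auto
  finally have drift_part: "D * (R\<^sup>2 / (R\<^sup>2 + \<delta>)) powr ((\<rho> + 2) / 2)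
      \<le> - (\<rho> * T powr (- \<rho> / 2 - 1) + 2 * \<epsilon>) * (trace A + \<beta> \<bullet> x)"
    by (simp only: mult_minus_right mult_minus_left)
  have "(S\<^sup>2 + 1) powr (- \<rho> / 2 - 2) \<le> T powr (- \<rho> / 2 - 2)"
    using assms T by (intro powr_mono2') auto
  moreover have "R\<^sup>2 / K \<le> x \<bullet> (A *v x)"
    using assms elliptic by (smt (verit) divide_right_mono power_mono)
  ultimately have "(S\<^sup>2 + 1) powr (- \<rho> / 2 - 2) * (R\<^sup>2 / K) \<le> T powr (- \<rho> / 2 - 2) * (x \<bullet> (A *v x))"
    using assms by (intro mult_mono) auto
  then have "\<rho> * (\<rho> + 2) * ((S\<^sup>2 + 1) powr (- \<rho> / 2 - 2) * (R\<^sup>2 / K))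
      \<le> \<rho> * (\<rho> + 2) * (T powr (- \<rho> / 2 - 2) * (x \<bullet> (A *v x)))"
    using assms by (intro mult_left_mono) auto
  with drift_part show ?thesis
    by (simp add: barrier_integrand_eq T_def mult.assoc)
qed

lemma exists_local_max_in_annulus:
  fixes f :: "'a::euclidean_space \<Rightarrow> real"
  assumes cont: "continuous_on UNIV f"
    and sphere: "\<And>x. norm x = R \<Longrightarrow> f x \<le> m"
    and outside: "\<And>x. S \<le> norm x \<Longrightarrow> f x \<le> m"
    and x1: "R \<le> norm x1" "m < f x1"
  obtains x0 where "R < norm x0" "norm x0 < S" "\<And>y. dist y x0 < norm x0 - R \<Longrightarrow> f y \<le> f x0"
proof -
  define annulus where "annulus = cball (0::'a) S - ball 0 R"
  have annulus_iff: "x \<in> annulus \<longleftrightarrow> R \<le> norm x \<and> norm x \<le> S" for x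
    by (auto simp: annulus_def)
  have "norm x1 < S"
    using x1 outside[of x1] by linarith
  then have x1_in: "x1 \<in> annulus"
    using x1 by (simp add: annulus_iff)
  have "compact annulus"
    unfolding annulus_def by (intro compact_diff compact_cball open_ball)
  then obtain x0 where x0: "x0 \<in> annulus" and max: "\<And>y. y \<in> annulus \<Longrightarrow> f y \<le> f x0"
    using continuous_attains_sup[of annulus f] continuous_on_subset[OF cont] x1_in by blast
  have above: "m < f x0"
    using max[OF x1_in] x1 by linarith
  then have "norm x0 \<noteq> R"
    using sphere[of x0] by force
  then have R_lt: "R < norm x0"
    using x0 by (simp add: annulus_iff)
  have lt_S: "norm x0 < S"
    using above outside[of x0] by linarith
  show thesis
  proof (rule that[OF R_lt lt_S])
    fix y assume "dist y x0 < norm x0 - R"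
    then have "R < norm y"
      using norm_triangle_ineq2[of x0 y] by (simp add: dist_norm norm_minus_commute)
    then show "f y \<le> f x0"
      using max[of y] outside[of y] above by (cases "norm y \<le> S") (auto simp: annulus_iff)
  qed
qed

lemma diffusion_drift_bounds:
  fixes S :: "real^'m^'n" and \<beta> x :: "real^'n"
  assumes "norm S \<le> K" "norm \<beta> \<le> K"
  shows "\<bar>trace (S ** transpose S) + \<beta> \<bullet> x\<bar> \<le> K\<^sup>2 + K * norm x"
    and "\<bar>x \<bullet> ((S ** transpose S) *v x)\<bar> \<le> (K * norm x)\<^sup>2"
proof -
  have "(norm S)\<^sup>2 \<le> K\<^sup>2"
    using assms(1) by (simp add: power_mono)
  moreover have "\<bar>\<beta> \<bullet> x\<bar> \<le> K * norm x"
    using assms(2) Cauchy_Schwarz_ineq2[of \<beta> x] by (meson mult_right_mono norm_ge_zero order_trans)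
  ultimately
  show "\<bar>trace (S ** transpose S) + \<beta> \<bullet> x\<bar> \<le> K\<^sup>2 + K * norm x"
    unfolding trace_mult_transpose_self by (smt (verit) zero_le_power2)
  have "norm (transpose S *v x) \<le> K * norm x"
    using norm_matrix_vector_mult_le[of "transpose S" x] assms(1)
    by (simp add: norm_transpose) (meson mult_right_mono norm_ge_zero order_trans)
  then show "\<bar>x \<bullet> ((S ** transpose S) *v x)\<bar> \<le> (K * norm x)\<^sup>2"
    by (simp add: inner_mult_transpose_self power_mono)
qed

lemma bdd_above_diffusion_integrand:
  assumes "\<And>\<alpha>. norm (\<sigma> x \<alpha>) + norm (b x \<alpha>) \<le> K" "\<And>\<alpha>. \<bar>l x \<alpha>\<bar> \<le> L"
  shows "bdd_above (range (\<lambda>\<alpha>. c1 * (trace (diffm \<sigma> x \<alpha>) + b x \<alpha> \<bullet> x)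
           + c2 * (x \<bullet> (diffm \<sigma> x \<alpha> *v x)) - l x \<alpha>))"
proof (rule bdd_aboveI2)
  fix \<alpha>
  have scaled: "c * t \<le> \<bar>c\<bar> * B" if "\<bar>t\<bar> \<le> B" for c t B :: real
    using that abs_ge_self[of "c * t"] mult_left_mono[OF that, of "\<bar>c\<bar>"] by (simp add: abs_mult)
  have "norm (\<sigma> x \<alpha>) \<le> K" "norm (b x \<alpha>) \<le> K"
    using assms(1)[of \<alpha>] norm_ge_zero[of "\<sigma> x \<alpha>"] norm_ge_zero[of "b x \<alpha>"] by linarith+
  note bounds = diffusion_drift_bounds[OF this, where x = x]
  have "c1 * (trace (diffm \<sigma> x \<alpha>) + b x \<alpha> \<bullet> x) \<le> \<bar>c1\<bar> * (K\<^sup>2 + K * norm x)"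
    and "c2 * (x \<bullet> (diffm \<sigma> x \<alpha> *v x)) \<le> \<bar>c2\<bar> * (K * norm x)\<^sup>2"
    using bounds unfolding diffm_def by (auto intro: scaled)
  then show "c1 * (trace (diffm \<sigma> x \<alpha>) + b x \<alpha> \<bullet> x) + c2 * (x \<bullet> (diffm \<sigma> x \<alpha> *v x)) - l x \<alpha>
      \<le> \<bar>c1\<bar> * (K\<^sup>2 + K * norm x) + \<bar>c2\<bar> * (K * norm x)\<^sup>2 + L"
    using assms(2)[of \<alpha>] by linarith
qed

lemma drift_le_of_SUP_le:
  assumes "\<And>\<alpha>. norm (\<sigma> x \<alpha>) + norm (b x \<alpha>) \<le> K"
    and "(SUP \<alpha>. trace (diffm \<sigma> x \<alpha>) + b x \<alpha> \<bullet> x) \<le> B"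
  shows "trace (diffm \<sigma> x \<alpha>) + b x \<alpha> \<bullet> x \<le> B"
proof -
  have "bdd_above (range (\<lambda>\<alpha>. trace (diffm \<sigma> x \<alpha>) + b x \<alpha> \<bullet> x))"
    using bdd_above_diffusion_integrand[of \<sigma> x b K "\<lambda>_ _. 0" 0 1 0] assms(1) by simp
  from cSUP_upper[OF UNIV_I this] show ?thesis
    using assms(2) by (rule order_trans)
qed

lemma le_bellman_if_le_integrand:
  assumes "F = bellman_inf \<sigma> b l \<or> F = bellman_sup \<sigma> b l"
    and "\<And>\<alpha>. v \<le> - trace (diffm \<sigma> x \<alpha> ** X) - b x \<alpha> \<bullet> p - l x \<alpha>"
    and "bdd_above (range (\<lambda>\<alpha>. - trace (diffm \<sigma> x \<alpha> ** X) - b x \<alpha> \<bullet> p - l x \<alpha>))"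
  shows "v \<le> F x p X"
  using assms(1)
proof
  assume "F = bellman_inf \<sigma> b l"
  then show ?thesis
    unfolding bellman_inf_def by (auto intro: cINF_greatest assms(2))
next
  assume "F = bellman_sup \<sigma> b l"
  then show ?thesis
    unfolding bellman_sup_def by (auto intro: cSUP_upper2[OF assms(3) UNIV_I] assms(2))
qed

lemma barrier_bellman_gt:
  fixes \<sigma> :: "real^'n \<Rightarrow> 'a \<Rightarrow> real^'m^'n"
  assumes F_def: "F = bellman_inf \<sigma> b l \<or> F = bellman_sup \<sigma> b l"
    and l_bound: "\<And>\<alpha>. \<bar>l x \<alpha>\<bar> \<le> L"
    and drift: "\<And>\<alpha>. trace (diffm \<sigma> x \<alpha>) + b x \<alpha> \<bullet> x \<le> - ((2 * \<bar>c\<bar> + L) / \<rho>) * norm x powr (2 + \<rho>)"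
    and bounded: "\<And>\<alpha>. norm (\<sigma> x \<alpha>) + norm (b x \<alpha>) \<le> K'"
    and elliptic: "\<And>\<alpha>. (norm x)\<^sup>2 / K \<le> x \<bullet> (diffm \<sigma> x \<alpha> *v x)" "0 < K"
    and parameters: "0 < \<rho>" "0 < R" "R \<le> norm x" "norm x \<le> S" "0 < \<delta>" "\<delta> \<le> 1" "0 \<le> \<epsilon>"
    and small_\<delta>: "(2 * \<bar>c\<bar> + L) * (1 - (R\<^sup>2 / (R\<^sup>2 + \<delta>)) powr ((\<rho> + 2) / 2))
      < \<rho> * (\<rho> + 2) * (S\<^sup>2 + 1) powr (- \<rho> / 2 - 2) * R\<^sup>2 / K"
  shows "c < F x (barrier_gradient \<rho> \<delta> \<epsilon> x) (barrier_hessian \<rho> \<delta> \<epsilon> x)"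
proof -
  define D where "D = 2 * \<bar>c\<bar> + L"
  define v where "v = D * (R\<^sup>2 / (R\<^sup>2 + \<delta>)) powr ((\<rho> + 2) / 2)
    + \<rho> * (\<rho> + 2) * (S\<^sup>2 + 1) powr (- \<rho> / 2 - 2) * R\<^sup>2 / K - L"
  have "0 \<le> L" using l_bound[of undefined] by linarith
  then have "0 \<le> D" by (simp add: D_def)
  have "c < v"
    using small_\<delta> unfolding v_def D_def by (simp add: algebra_simps)
  moreover have "v \<le> - trace (diffm \<sigma> x \<alpha> ** barrier_hessian \<rho> \<delta> \<epsilon> x)
      - b x \<alpha> \<bullet> barrier_gradient \<rho> \<delta> \<epsilon> x - l x \<alpha>" for \<alpha>
    using barrier_integrand_ge[OF parameters \<open>0 \<le> D\<close> \<open>0 < K\<close> drift[of \<alpha>, folded D_def] elliptic(1)]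
      l_bound[of \<alpha>]
    unfolding v_def by linarith
  moreover have "bdd_above (range (\<lambda>\<alpha>. - trace (diffm \<sigma> x \<alpha> ** barrier_hessian \<rho> \<delta> \<epsilon> x)
      - b x \<alpha> \<bullet> barrier_gradient \<rho> \<delta> \<epsilon> x - l x \<alpha>))"
    using bdd_above_diffusion_integrand[of \<sigma> x b K' l L] bounded l_bound
    by (simp add: barrier_integrand_eq)
  ultimately show ?thesis
    using le_bellman_if_le_integrand[OF F_def] by (meson less_le_trans)
qed

lemma offset_powr_le:
  fixes R t \<delta> \<rho> :: real
  assumes "0 < R" "R \<le> t" "0 \<le> \<delta>" "0 \<le> \<rho>"
  shows "(t\<^sup>2 + \<delta>) powr (- \<rho> / 2) \<le> 1 / R powr \<rho>"
proof -
  have "R\<^sup>2 \<le> t\<^sup>2 + \<delta>"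
    using assms by (smt (verit) power_mono)
  then have "(t\<^sup>2 + \<delta>) powr (- \<rho> / 2) \<le> (R\<^sup>2) powr (- \<rho> / 2)"
    using assms by (intro powr_mono2') auto
  then show ?thesis
    using assms by (simp add: one_div_powr_eq_square_powr)
qed

lemma barrier_lower_bound:
  assumes "0 < R" "R \<le> norm x" "0 \<le> \<delta>" "0 \<le> \<rho>"
  shows "\<epsilon> * (norm x)\<^sup>2 - 1 / R powr \<rho> \<le> barrier \<rho> \<delta> \<epsilon> x"
  using offset_powr_le[OF assms] by (simp add: barrier_def)

lemma barrier_offset_exists:
  fixes R s \<rho> \<eta> D E :: real
  assumes "0 < R" "0 < s" "0 < \<rho>" "0 < \<eta>" "0 < E"
  obtains \<delta> where "0 < \<delta>" "\<delta> \<le> 1"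
    "D * (1 - (R\<^sup>2 / (R\<^sup>2 + \<delta>)) powr ((\<rho> + 2) / 2)) < E"
    "1 / s powr \<rho> - \<eta> < (s\<^sup>2 + \<delta>) powr (- \<rho> / 2)"
proof -
  have "((\<lambda>\<delta>. D * (1 - (R\<^sup>2 / (R\<^sup>2 + \<delta>)) powr ((\<rho> + 2) / 2))) \<longlongrightarrow>
      D * (1 - (R\<^sup>2 / (R\<^sup>2 + 0)) powr ((\<rho> + 2) / 2))) (at_right 0)"
    using assms by (intro tendsto_intros) auto
  then have "\<forall>\<^sub>F \<delta> in at_right 0. D * (1 - (R\<^sup>2 / (R\<^sup>2 + \<delta>)) powr ((\<rho> + 2) / 2)) < E"
    using assms by (auto elim: order_tendstoD)
  moreover have "((\<lambda>\<delta>. (s\<^sup>2 + \<delta>) powr (- \<rho> / 2)) \<longlongrightarrow> (s\<^sup>2 + 0) powr (- \<rho> / 2)) (at_right 0)"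
    using assms by (intro tendsto_intros) auto
  then have "\<forall>\<^sub>F \<delta> in at_right 0. 1 / s powr \<rho> - \<eta> < (s\<^sup>2 + \<delta>) powr (- \<rho> / 2)"
    using assms by (auto simp: one_div_powr_eq_square_powr elim: order_tendstoD)
  moreover have "\<forall>\<^sub>F \<delta> in at_right (0::real). 0 < \<delta> \<and> \<delta> \<le> 1"
    unfolding eventually_at_right_field by (intro exI[of _ 1]) auto
  ultimately have "\<forall>\<^sub>F \<delta> in at_right (0::real). 0 < \<delta> \<and> \<delta> \<le> 1 \<and>
      D * (1 - (R\<^sup>2 / (R\<^sup>2 + \<delta>)) powr ((\<rho> + 2) / 2)) < E \<and> 1 / s powr \<rho> - \<eta> < (s\<^sup>2 + \<delta>) powr (- \<rho> / 2)"
    by eventually_elim auto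
  then show thesis
    using that eventually_happens'[of "at_right (0::real)"] by force
qed

lemma eventually_le_square_of_growth:
  fixes u :: "'a::real_normed_vector \<Rightarrow> real"
  assumes growth: "((\<lambda>x. u x / (norm x)\<^sup>2) \<longlongrightarrow> 0) at_infinity" and "0 < \<epsilon>"
  obtains S where "\<And>x. S \<le> norm x \<Longrightarrow> u x + Q \<le> \<epsilon> * (norm x)\<^sup>2"
proof -
  have "((\<lambda>x. Q / (norm x)\<^sup>2) \<longlongrightarrow> 0) at_infinity"
    by (intro tendsto_divide_0[OF tendsto_const] filterlim_at_top_imp_at_infinity
        filterlim_pow_at_top filterlim_norm_at_top) simp
  from tendsto_add[OF growth this]
  have "\<forall>\<^sub>F x in at_infinity. u x / (norm x)\<^sup>2 + Q / (norm x)\<^sup>2 < \<epsilon>"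
    using assms(2) by (auto elim: order_tendstoD)
  then obtain S where S: "\<And>x. S \<le> norm x \<Longrightarrow> u x / (norm x)\<^sup>2 + Q / (norm x)\<^sup>2 < \<epsilon>"
    unfolding eventually_at_infinity by blast
  show thesis
  proof (rule that[of "max S 1"])
    fix x :: 'a assume x: "max S 1 \<le> norm x"
    then have "0 < (norm x)\<^sup>2"
      by (smt (verit) zero_less_power)
    then show "u x + Q \<le> \<epsilon> * (norm x)\<^sup>2"
      using S[of x] x by (simp add: add_divide_distrib[symmetric] pos_divide_less_eq less_imp_le)
  qed
qed

lemma visc_subsol_barrier_comparison:
  fixes \<sigma> :: "real^'n \<Rightarrow> 'a \<Rightarrow> real^'m^'n" and u :: "real^'n \<Rightarrow> real"
  assumes F_def: "F = bellman_inf \<sigma> b l \<or> F = bellman_sup \<sigma> b l"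
    and l_bound: "\<And>x \<alpha>. \<bar>l x \<alpha>\<bar> \<le> L"
    and sub: "visc_subsol F c u"
    and drift: "\<And>x \<alpha>. R \<le> norm x \<Longrightarrow>
      trace (diffm \<sigma> x \<alpha>) + b x \<alpha> \<bullet> x \<le> - ((2 * \<bar>c\<bar> + L) / \<rho>) * norm x powr (2 + \<rho>)"
    and bounded: "\<And>x \<alpha>. norm x \<le> S \<Longrightarrow> norm (\<sigma> x \<alpha>) + norm (b x \<alpha>) \<le> K'"
    and elliptic: "\<And>x \<alpha>. norm x \<le> S \<Longrightarrow> (norm x)\<^sup>2 / K \<le> x \<bullet> (diffm \<sigma> x \<alpha> *v x)" "0 < K"
    and parameters: "0 < \<rho>" "0 < R" "0 < \<delta>" "\<delta> \<le> 1" "0 \<le> \<epsilon>"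
    and small_\<delta>: "(2 * \<bar>c\<bar> + L) * (1 - (R\<^sup>2 / (R\<^sup>2 + \<delta>)) powr ((\<rho> + 2) / 2))
      < \<rho> * (\<rho> + 2) * (S\<^sup>2 + 1) powr (- \<rho> / 2 - 2) * R\<^sup>2 / K"
    and sphere: "\<And>x. norm x = R \<Longrightarrow> u x - barrier \<rho> \<delta> \<epsilon> x \<le> m"
    and outside: "\<And>x. S \<le> norm x \<Longrightarrow> u x - barrier \<rho> \<delta> \<epsilon> x \<le> m"
    and x1: "R \<le> norm x1"
  shows "u x1 - barrier \<rho> \<delta> \<epsilon> x1 \<le> m"
proof (rule ccontr)
  assume "\<not> ?thesis"
  then have above: "m < u x1 - barrier \<rho> \<delta> \<epsilon> x1" by simp
  have C2: "C2_with (barrier \<rho> \<delta> \<epsilon>) (barrier_gradient \<rho> \<delta> \<epsilon>) (barrier_hessian \<rho> \<delta> \<epsilon>)"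
    using parameters by (intro C2_with_barrier)
  then have "continuous_on UNIV (barrier \<rho> \<delta> \<epsilon> :: real^'n \<Rightarrow> real)"
    unfolding C2_with_def by (meson has_derivative_at_withinI has_derivative_continuous_on)
  then have cont: "continuous_on UNIV (\<lambda>x. u x - barrier \<rho> \<delta> \<epsilon> x)"
    using sub by (intro continuous_on_diff) (auto simp: visc_subsol_def)
  obtain x0 where x0: "R < norm x0" "norm x0 < S"
    and max: "\<And>y. dist y x0 < norm x0 - R \<Longrightarrow> u y - barrier \<rho> \<delta> \<epsilon> y \<le> u x0 - barrier \<rho> \<delta> \<epsilon> x0"
    using exists_local_max_in_annulus[OF cont sphere outside x1 above] by blast
  have "F x0 (barrier_gradient \<rho> \<delta> \<epsilon> x0) (barrier_hessian \<rho> \<delta> \<epsilon> x0) \<le> c"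
    using sub C2 max x0(1) unfolding visc_subsol_def by (metis diff_gt_0_iff_gt)
  moreover have "c < F x0 (barrier_gradient \<rho> \<delta> \<epsilon> x0) (barrier_hessian \<rho> \<delta> \<epsilon> x0)"
    using x0 by (intro barrier_bellman_gt[OF F_def l_bound drift bounded elliptic(1) elliptic(2)
        parameters(1,2) _ _ parameters(3-5) small_\<delta>]) auto
  ultimately show False by linarith
qed

lemma visc_subsol_le_ball_sup:
  fixes \<sigma> :: "real^'n \<Rightarrow> 'a \<Rightarrow> real^'m^'n" and u :: "real^'n \<Rightarrow> real"
  assumes F_def: "F = bellman_inf \<sigma> b l \<or> F = bellman_sup \<sigma> b l"
    and bounded: "\<And>r. 0 < r \<Longrightarrow> \<exists>K. \<forall>x \<alpha>. norm x \<le> r \<longrightarrow> norm (\<sigma> x \<alpha>) + norm (b x \<alpha>) \<le> K"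
    and elliptic: "\<And>r. 0 < r \<Longrightarrow>
      \<exists>K>0. \<forall>\<xi> x \<alpha>. norm x \<le> r \<longrightarrow> (norm \<xi>)\<^sup>2 / K \<le> \<xi> \<bullet> (diffm \<sigma> x \<alpha> *v \<xi>)"
    and l_bound: "\<And>x \<alpha>. \<bar>l x \<alpha>\<bar> \<le> L"
    and sub: "visc_subsol F c u"
    and growth: "((\<lambda>x. u x / (norm x)\<^sup>2) \<longlongrightarrow> 0) at_infinity"
    and "0 < \<rho>" "0 < R"
    and drift: "\<And>x \<alpha>. R \<le> norm x \<Longrightarrow>
      trace (diffm \<sigma> x \<alpha>) + b x \<alpha> \<bullet> x \<le> - ((2 * \<bar>c\<bar> + L) / \<rho>) * norm x powr (2 + \<rho>)"
    and x1: "R \<le> norm x1"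
  shows "u x1 \<le> (SUP y\<in>cball 0 R. u y) - 1 / norm x1 powr \<rho> + 1 / R powr \<rho>"
proof (rule ccontr)
  define M where "M = (SUP y\<in>cball 0 R. u y)"
  define \<eta> where "\<eta> = u x1 - (M - 1 / norm x1 powr \<rho> + 1 / R powr \<rho>)"
  assume "\<not> ?thesis"
  then have "0 < \<eta>" by (simp add: \<eta>_def M_def)
  have u_x1: "u x1 = M - 1 / norm x1 powr \<rho> + 1 / R powr \<rho> + \<eta>"
    by (simp add: \<eta>_def)
  have "bdd_above (u ` cball 0 R)"
    using sub unfolding visc_subsol_def
    by (intro bounded_imp_bdd_above compact_imp_bounded compact_continuous_image)
      (auto intro: continuous_on_subset)
  then have u_le_M: "u y \<le> M" if "norm y \<le> R" for y
    unfolding M_def using that by (intro cSUP_upper) auto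
  define \<epsilon> where "\<epsilon> = \<eta> / (2 * ((norm x1)\<^sup>2 + 1))"
  have "0 < \<epsilon>" using \<open>0 < \<eta>\<close> by (simp add: \<epsilon>_def add_nonneg_pos)
  have "\<epsilon> * (norm x1)\<^sup>2 = \<eta> / 2 * ((norm x1)\<^sup>2 / ((norm x1)\<^sup>2 + 1))"
    by (simp add: \<epsilon>_def)
  also have "\<dots> \<le> \<eta> / 2"
    using \<open>0 < \<eta>\<close> by (intro mult_left_le) (auto simp: add_nonneg_pos)
  finally have "\<epsilon> * (norm x1)\<^sup>2 \<le> \<eta> / 2" .
  obtain S0 where S0: "\<And>x. S0 \<le> norm x \<Longrightarrow> u x + (\<bar>M\<bar> + 1 / R powr \<rho>) \<le> \<epsilon> * (norm x)\<^sup>2"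
    using eventually_le_square_of_growth[OF growth \<open>0 < \<epsilon>\<close>] by blast
  define S where "S = max S0 (max R 1)"
  have "0 < S" "R \<le> S" by (auto simp: S_def)
  obtain Kb where Kb: "\<And>x \<alpha>. norm x \<le> S \<Longrightarrow> norm (\<sigma> x \<alpha>) + norm (b x \<alpha>) \<le> Kb"
    using bounded[OF \<open>0 < S\<close>] by blast
  obtain K where "0 < K" and K: "\<And>x \<alpha>. norm x \<le> S \<Longrightarrow> (norm x)\<^sup>2 / K \<le> x \<bullet> (diffm \<sigma> x \<alpha> *v x)"
    using elliptic[OF \<open>0 < S\<close>] by blast
  have "0 < \<rho> * (\<rho> + 2) * (S\<^sup>2 + 1) powr (- \<rho> / 2 - 2) * R\<^sup>2 / K"
    using \<open>0 < \<rho>\<close> \<open>0 < R\<close> \<open>0 < K\<close> add_nonneg_pos[of "S\<^sup>2" 1]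
    by (intro divide_pos_pos mult_pos_pos) auto
  moreover have "0 < norm x1" using x1 \<open>0 < R\<close> by linarith
  ultimately obtain \<delta> where \<delta>: "0 < \<delta>" "\<delta> \<le> 1"
    "(2 * \<bar>c\<bar> + L) * (1 - (R\<^sup>2 / (R\<^sup>2 + \<delta>)) powr ((\<rho> + 2) / 2))
       < \<rho> * (\<rho> + 2) * (S\<^sup>2 + 1) powr (- \<rho> / 2 - 2) * R\<^sup>2 / K"
    "1 / norm x1 powr \<rho> - \<eta> / 2 < ((norm x1)\<^sup>2 + \<delta>) powr (- \<rho> / 2)"
    using barrier_offset_exists[OF \<open>0 < R\<close> _ \<open>0 < \<rho>\<close> half_gt_zero[OF \<open>0 < \<eta>\<close>]] by blast
  define m where "m = M + (R\<^sup>2 + \<delta>) powr (- \<rho> / 2)"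
  have "u x1 - barrier \<rho> \<delta> \<epsilon> x1 \<le> m"
  proof (rule visc_subsol_barrier_comparison[OF F_def l_bound sub drift Kb K \<open>0 < K\<close>
        \<open>0 < \<rho>\<close> \<open>0 < R\<close> \<delta>(1,2) less_imp_le[OF \<open>0 < \<epsilon>\<close>] \<delta>(3) _ _ x1])
    show "u x - barrier \<rho> \<delta> \<epsilon> x \<le> m" if "norm x = R" for x
      using u_le_M[of x] that \<open>0 < \<epsilon>\<close>
      by (simp add: m_def barrier_def diff_le_eq add_increasing2)
    show "u x - barrier \<rho> \<delta> \<epsilon> x \<le> m" if "S \<le> norm x" for x
      using S0[of x] barrier_lower_bound[of R x \<delta> \<rho> \<epsilon>] that \<open>R \<le> S\<close> \<open>0 < R\<close> \<delta>(1) \<open>0 < \<rho>\<close>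
        S_def abs_ge_minus_self[of M] powr_ge_zero[of "R\<^sup>2 + \<delta>" "- \<rho> / 2"]
      unfolding m_def by linarith
  qed
  moreover have "(R\<^sup>2 + \<delta>) powr (- \<rho> / 2) \<le> 1 / R powr \<rho>"
    using \<open>0 < R\<close> \<delta>(1) \<open>0 < \<rho>\<close> by (intro offset_powr_le) auto
  ultimately show False
    using \<delta>(4) \<open>\<epsilon> * (norm x1)\<^sup>2 \<le> \<eta> / 2\<close> u_x1 unfolding m_def barrier_def by linarith
qed

lemma visc_supersol_ge_ball_inf:
  fixes \<sigma> :: "real^'n \<Rightarrow> 'a \<Rightarrow> real^'m^'n" and u :: "real^'n \<Rightarrow> real"
  assumes F_def: "F = bellman_inf \<sigma> b l \<or> F = bellman_sup \<sigma> b l"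
    and bounded: "\<And>r. 0 < r \<Longrightarrow> \<exists>K. \<forall>x \<alpha>. norm x \<le> r \<longrightarrow> norm (\<sigma> x \<alpha>) + norm (b x \<alpha>) \<le> K"
    and elliptic: "\<And>r. 0 < r \<Longrightarrow>
      \<exists>K>0. \<forall>\<xi> x \<alpha>. norm x \<le> r \<longrightarrow> (norm \<xi>)\<^sup>2 / K \<le> \<xi> \<bullet> (diffm \<sigma> x \<alpha> *v \<xi>)"
    and l_bound: "\<And>x \<alpha>. \<bar>l x \<alpha>\<bar> \<le> L"
    and super: "visc_supersol F c u"
    and growth: "((\<lambda>x. u x / (norm x)\<^sup>2) \<longlongrightarrow> 0) at_infinity"
    and "0 < \<rho>" "0 < R"
    and drift: "\<And>x \<alpha>. R \<le> norm x \<Longrightarrow>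
      trace (diffm \<sigma> x \<alpha>) + b x \<alpha> \<bullet> x \<le> - ((2 * \<bar>c\<bar> + L) / \<rho>) * norm x powr (2 + \<rho>)"
    and x1: "R \<le> norm x1"
  shows "(INF y\<in>cball 0 R. u y) + 1 / norm x1 powr \<rho> - 1 / R powr \<rho> \<le> u x1"
proof -
  define G where "G = (if F = bellman_inf \<sigma> b l then bellman_sup \<sigma> b (\<lambda>x \<alpha>. - l x \<alpha>)
    else bellman_inf \<sigma> b (\<lambda>x \<alpha>. - l x \<alpha>))"
  have "G x p X = - F x (- p) (- X)" for x p X
    using F_def by (auto simp: G_def bellman_sup_uminus bellman_inf_uminus)
  then have sub: "visc_subsol G (- c) (\<lambda>x. - u x)"
    by (rule visc_supersol_imp_visc_subsol_uminus[OF super])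
  have G_def': "G = bellman_inf \<sigma> b (\<lambda>x \<alpha>. - l x \<alpha>) \<or> G = bellman_sup \<sigma> b (\<lambda>x \<alpha>. - l x \<alpha>)"
    by (simp add: G_def)
  have growth': "((\<lambda>x. - u x / (norm x)\<^sup>2) \<longlongrightarrow> 0) at_infinity"
    using tendsto_minus[OF growth] by simp
  have "- u x1 \<le> (SUP y\<in>cball 0 R. - u y) - 1 / norm x1 powr \<rho> + 1 / R powr \<rho>"
    by (rule visc_subsol_le_ball_sup[where L = L, OF G_def' bounded elliptic _ sub growth' \<open>0 < \<rho>\<close> \<open>0 < R\<close> _ x1])
      (use l_bound drift in auto)
  moreover have "(INF y\<in>cball 0 R. u y) = - (SUP y\<in>cball 0 R. - u y)"
    by (simp add: Inf_real_def image_image)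
  ultimately show ?thesis by linarith
qed

lemma bounded_range_if_ball_bounds:
  fixes u :: "'a::euclidean_space \<Rightarrow> real"
  assumes "continuous_on UNIV u" "0 \<le> R" "0 \<le> C"
    and "\<And>x. R \<le> norm x \<Longrightarrow> (INF y\<in>cball 0 R. u y) - C \<le> u x \<and> u x \<le> (SUP y\<in>cball 0 R. u y) + C"
  shows "bounded (range u)"
proof -
  have "bounded (u ` cball 0 R)"
    by (intro compact_imp_bounded compact_continuous_image continuous_on_subset[OF assms(1)]) auto
  then obtain B where "\<forall>z\<in>u ` cball 0 R. norm z \<le> B"
    unfolding bounded_iff by blast
  then have B: "\<And>y. y \<in> cball 0 R \<Longrightarrow> \<bar>u y\<bar> \<le> B"
    by auto
  have "cball (0::'a) R \<noteq> {}" using assms(2) by simp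
  then have "(SUP y\<in>cball 0 R. u y) \<le> B" "- B \<le> (INF y\<in>cball 0 R. u y)"
    by (auto intro!: cSUP_least cINF_greatest dest!: B simp: abs_le_iff)
  then have "\<bar>u x\<bar> \<le> B + C" for x
  proof (cases "R \<le> norm x")
    case True
    then show ?thesis using assms(4)[of x] \<open>(SUP y\<in>cball 0 R. u y) \<le> B\<close> \<open>- B \<le> (INF y\<in>cball 0 R. u y)\<close>
      by (simp add: abs_le_iff)
  next
    case False
    then show ?thesis using B[of x] assms(3) by simp
  qed
  then show ?thesis
    by (auto simp: bounded_iff)
qed

lemma abs_le_sup_norm:
  assumes "bounded (range (\<lambda>z. l (fst z) (snd z)))"
  shows "\<bar>l x \<alpha>\<bar> \<le> sup_norm l"
proof -
  obtain a where "\<And>z. \<bar>l (fst z) (snd z)\<bar> \<le> a"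
    using assms unfolding bounded_iff by auto
  then have "bdd_above (range (\<lambda>z. \<bar>l (fst z) (snd z)\<bar>))"
    by (intro bdd_aboveI2)
  then show ?thesis
    unfolding sup_norm_def by (rule cSUP_upper2[OF _ UNIV_I[of "(x, \<alpha>)"]]) simp_all
qed

theorem theorem6p5:
  fixes \<sigma> :: "real^'n \<Rightarrow> 'a::metric_space \<Rightarrow> real^'m^'n"
    and b :: "real^'n \<Rightarrow> 'a \<Rightarrow> real^'n"
    and l :: "real^'n \<Rightarrow> 'a \<Rightarrow> real"
    and F :: "real^'n \<Rightarrow> real^'n \<Rightarrow> real^'n^'n \<Rightarrow> real"
    and u :: "real^'n \<Rightarrow> real"
    and c \<rho> R :: real
  assumes \<sigma>_cont: "continuous_on UNIV (\<lambda>z. \<sigma> (fst z) (snd z))"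
    and b_cont: "continuous_on UNIV (\<lambda>z. b (fst z) (snd z))"
    and loc: "\<forall>R'>0. \<exists>K>0.
        (\<forall>x \<alpha>. norm x \<le> R' \<longrightarrow> norm (\<sigma> x \<alpha>) + norm (b x \<alpha>) \<le> K) \<and>
        (\<forall>x y \<alpha>. norm x \<le> R' \<longrightarrow> norm y \<le> R' \<longrightarrow>
            norm (\<sigma> x \<alpha> - \<sigma> y \<alpha>) + norm (b x \<alpha> - b y \<alpha>) \<le> K * norm (x - y)) \<and>
        (\<forall>\<xi> x \<alpha>. norm x \<le> R' \<longrightarrow> \<xi> \<bullet> (diffm \<sigma> x \<alpha> *v \<xi>) \<ge> (norm \<xi>)\<^sup>2 / K)"
    and l_cont: "continuous_on UNIV (\<lambda>z. l (fst z) (snd z))"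
    and l_bdd: "bounded (range (\<lambda>z. l (fst z) (snd z)))"
    and l_uc: "\<forall>\<epsilon>>0. \<exists>\<delta>>0. \<forall>x y \<alpha>. dist x y < \<delta> \<longrightarrow> \<bar>l x \<alpha> - l y \<alpha>\<bar> < \<epsilon>"
    and F_def: "F = bellman_inf \<sigma> b l \<or> F = bellman_sup \<sigma> b l"
    and lyap: "\<forall>M>0. \<exists>R'>0. \<forall>x. norm x \<ge> R' \<longrightarrow>
        (SUP \<alpha>. trace (diffm \<sigma> x \<alpha>) + b x \<alpha> \<bullet> x) \<le> - M"
    and sol: "visc_sol F c u"
    and growth: "((\<lambda>x. u x / (norm x)\<^sup>2) \<longlongrightarrow> 0) at_infinity"
    and \<rho>_pos: "\<rho> > 0" and R_pos: "R > 0"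
    and strong: "\<forall>x. norm x \<ge> R \<longrightarrow>
        (SUP \<alpha>. trace (diffm \<sigma> x \<alpha>) + b x \<alpha> \<bullet> x)
          \<le> - ((2 * \<bar>c\<bar> + sup_norm l) / \<rho>) * norm x powr (2 + \<rho>)"
  shows "(\<forall>x. norm x \<ge> R \<longrightarrow>
           (INF y\<in>cball 0 R. u y) + 1 / norm x powr \<rho> - 1 / R powr \<rho> \<le> u x \<and>
           u x \<le> (SUP y\<in>cball 0 R. u y) - 1 / norm x powr \<rho> + 1 / R powr \<rho>)
         \<and> bounded (range u)"
proof -
  txt \<open>The continuity hypotheses and the weak Lyapunov condition \<open>lyap\<close> only serve the existence
    of \<open>(c, \<chi>)\<close>; the estimate needs just the strong Lyapunov bound.\<close>
  define L where "L = sup_norm l"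
  have l_bound: "\<bar>l x \<alpha>\<bar> \<le> L" for x \<alpha>
    unfolding L_def using l_bdd by (rule abs_le_sup_norm)
  have bounded: "\<exists>K. \<forall>x \<alpha>. norm x \<le> r \<longrightarrow> norm (\<sigma> x \<alpha>) + norm (b x \<alpha>) \<le> K"
    and elliptic: "\<exists>K>0. \<forall>\<xi> x \<alpha>. norm x \<le> r \<longrightarrow> (norm \<xi>)\<^sup>2 / K \<le> \<xi> \<bullet> (diffm \<sigma> x \<alpha> *v \<xi>)"
    if "0 < r" for r
    using loc that by blast+
  have drift: "trace (diffm \<sigma> x \<alpha>) + b x \<alpha> \<bullet> x \<le> - ((2 * \<bar>c\<bar> + L) / \<rho>) * norm x powr (2 + \<rho>)"
    if x: "R \<le> norm x" for x \<alpha>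
  proof -
    obtain K where "\<And>\<alpha>. norm (\<sigma> x \<alpha>) + norm (b x \<alpha>) \<le> K"
      using bounded[of "norm x"] x R_pos by force
    then show ?thesis
      by (rule drift_le_of_SUP_le) (use strong x in \<open>simp add: L_def\<close>)
  qed
  have "visc_subsol F c u" "visc_supersol F c u" "continuous_on UNIV u"
    using sol by (simp_all add: visc_sol_def visc_subsol_def)
  then have bounds: "(INF y\<in>cball 0 R. u y) + 1 / norm x powr \<rho> - 1 / R powr \<rho> \<le> u x \<and>
      u x \<le> (SUP y\<in>cball 0 R. u y) - 1 / norm x powr \<rho> + 1 / R powr \<rho>" if "R \<le> norm x" for x
    using visc_subsol_le_ball_sup[OF F_def bounded elliptic l_bound _ growth \<rho>_pos R_pos drift that]
      visc_supersol_ge_ball_inf[OF F_def bounded elliptic l_bound _ growth \<rho>_pos R_pos drift that]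
    by blast
  moreover have "bounded (range u)"
  proof (rule bounded_range_if_ball_bounds[OF \<open>continuous_on UNIV u\<close>])
    fix x :: "real^'n" assume "R \<le> norm x"
    moreover have "0 \<le> 1 / norm x powr \<rho>" by simp
    ultimately show "(INF y\<in>cball 0 R. u y) - 1 / R powr \<rho> \<le> u x \<and> u x \<le> (SUP y\<in>cball 0 R. u y) + 1 / R powr \<rho>"
      using bounds[of x] by linarith
  qed (use R_pos in auto)
  ultimately show ?thesis by blast
qed

end
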